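(* Let $A\succ0$ be a $d\times d$ real symmetric matrix with smallest eigenvalue $\lambda_{\min}^A$. In the adversarial setting with hitting costs $f_t(x)=\frac12(x-v_t)^TA(x-v_t)$ and switching costs $c(x_t,x_{t-1})=\frac12\|x_t-x_{t-1}\|_2^2$, the competitive ratio of the LAI algorithm satisfies $$\mathrm{CR}_{\mathrm{LAI}}\le 1+\frac{1}{\lambda_{\min}^A}.$$
   Context: Starting from a given $x_0\in\mathbb{R}^d$, at each round $t=1,\dots,T$ an arbitrary (adversarial) vector $v_t\in\mathbb{R}^d$ is revealed and the player picks $x_t\in\mathbb{R}^d$; the total cost is $\mathrm{Cost}[1,T]=\sum_{t=1}^T\left(f_t(x_t)+\frac12\|x_t-x_{t-1}\|_2^2\right)$. $\mathrm{Cost}_{\mathrm{OPT}}[1,T]$ is the minimum of this cost over all $(x_1,\dots,x_T)\in(\mathbb{R}^d)^T$, chosen in hindsight knowing $v_1,\dots,v_T$, with the same $x_0$. The competitive ratio $\mathrm{CR}_{\mathrm{ALG}}$ is the worst-case ratio $\mathrm{Cost}_{\mathrm{ALG}}[1,T]/\mathrm{Cost}_{\mathrm{OPT}}[1,T]$ over all horizons $T$, initial points and sequences $\{v_t\}$; $\mathrm{CR}_{\mathrm{ALG}}\le\rho$ means $\mathrm{Cost}_{\mathrm{ALG}}[1,T]\le\rho\,\mathrm{Cost}_{\mathrm{OPT}}[1,T]$ for every instance. LAI (Lazy Adaptive Interpolation) with horizon $T$ is $x_t=C_tx_{t-1}+(I-C_t)v_t$, where $C_T=(I+A)^{-1}$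 and $C_t^{-1}=2I+A-C_{t+1}$ for $1\le t\le T-1$. *)

theory Defs
  imports "HOL-Analysis.Analysis"
begin

definition pos_def :: "real^'n^'n \<Rightarrow> bool" where
  "pos_def A \<longleftrightarrow> transpose A = A \<and> (\<forall>x. x \<noteq> 0 \<longrightarrow> x \<bullet> (A *v x) > 0)"

definition eigenvalues :: "real^'n^'n \<Rightarrow> real set" where
  "eigenvalues A = {c. \<exists>u. u \<noteq> 0 \<and> A *v u = c *\<^sub>R u}"

text \<open>Meaningful for symmetric matrices, whose set of real eigenvalues is finite and nonempty.\<close>
definition lambda_min :: "real^'n^'n \<Rightarrow> real" where
  "lambda_min A = Min (eigenvalues A)"

definition hitting_cost :: "real^'n^'n \<Rightarrow> real^'n \<Rightarrow> real^'n \<Rightarrow> real" where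
  "hitting_cost A v x = 1/2 * ((x - v) \<bullet> (A *v (x - v)))"

definition switching_cost :: "real^'n \<Rightarrow> real^'n \<Rightarrow> real" where
  "switching_cost x y = 1/2 * (norm (x - y))\<^sup>2"

text \<open>A trajectory is a function \<open>x\<close> on \<open>nat\<close> whose value \<open>x 0\<close> is the initial point; only
  \<open>x 0, \<dots>, x T\<close> and \<open>v 1, \<dots>, v T\<close> matter for horizon \<open>T\<close>.\<close>
definition total_cost ::
  "real^'n^'n \<Rightarrow> nat \<Rightarrow> (nat \<Rightarrow> real^'n) \<Rightarrow> (nat \<Rightarrow> real^'n) \<Rightarrow> real" where
  "total_cost A T v x =
     (\<Sum>t=1..T. (hitting_cost A (v t) (x t) + switching_cost (x t) (x (t - 1))))"

text \<open>For positive definite \<open>A\<close> the costs are nonnegative and the infimum is attained, so it is the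
  hindsight minimum.\<close>
definition opt_cost :: "real^'n^'n \<Rightarrow> nat \<Rightarrow> real^'n \<Rightarrow> (nat \<Rightarrow> real^'n) \<Rightarrow> real" where
  "opt_cost A T x0 v = (INF x\<in>{x. x 0 = x0}. total_cost A T v x)"

text \<open>An algorithm maps a horizon, an initial point and a sequence \<open>v\<close> to a trajectory. The bound is
  stated without division, so that instances of zero optimal cost are covered as well.\<close>
definition competitive_ratio_le ::
  "real^'n^'n \<Rightarrow> (nat \<Rightarrow> real^'n \<Rightarrow> (nat \<Rightarrow> real^'n) \<Rightarrow> nat \<Rightarrow> real^'n) \<Rightarrow> real \<Rightarrow> bool" where
  "competitive_ratio_le A alg \<rho> \<longleftrightarrow>
     (\<forall>T\<ge>1. \<forall>x0 v. total_cost A T v (alg T x0 v) \<le> \<rho> * opt_cost A T x0 v)"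

text \<open>The matrices \<open>C\<^sub>t\<close> for horizon \<open>T\<close>, by backward recursion from \<open>C\<^sub>T\<close>. All inverted matrices are
  invertible when \<open>A\<close> is positive definite. Values at \<open>t > T\<close> are irrelevant.\<close>
function lai_C :: "real^'n^'n \<Rightarrow> nat \<Rightarrow> nat \<Rightarrow> real^'n^'n" where
  "lai_C A T t =
     (if t < T then matrix_inv (2 *\<^sub>R mat 1 + A - lai_C A T (Suc t))
      else matrix_inv (mat 1 + A))"
  by pat_completeness auto
termination
  by (relation "Wellfounded.measure (\<lambda>(A, T, t). T - t)") auto

declare lai_C.simps [simp del]

primrec lai ::
  "real^'n^'n \<Rightarrow> nat \<Rightarrow> real^'n \<Rightarrow> (nat \<Rightarrow> real^'n) \<Rightarrow> nat \<Rightarrow> real^'n" where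
  "lai A T x0 v 0 = x0"
| "lai A T x0 v (Suc t) =
     lai_C A T (Suc t) *v lai A T x0 v t + (mat 1 - lai_C A T (Suc t)) *v v (Suc t)"

end

theory Submission imports Defs begin

text \<open>In an orthonormal eigenbasis of \<open>A\<close> both costs and LAI decouple, so it suffices to treat each
  eigenvalue \<open>a > 0\<close> in dimension one. If the target stays at \<open>v\<close> for the remaining \<open>n\<close> rounds, the
  optimal cost from \<open>x\<close> is \<open>1/2 * p n * (x - v)\<^sup>2\<close>, where \<open>p n\<close> is \<open>cost_to_go a n\<close>: \<open>p 0 = 0\<close>, \<open>p (n + 1) = 1 - 1 / (1 + a + p n)\<close>,
  and the LAI coefficient with \<open>n\<close> rounds to follow is \<open>1 / (1 + a + p n)\<close>. Compared with an arbitrary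
  trajectory \<open>z\<close>, the potential \<open>1/2 * (1 + a) * p n * (x - z)\<^sup>2\<close> increases in each round by at most
  \<open>1 + 1/a\<close> times the cost of \<open>z\<close> minus the cost of LAI; it vanishes at the start, where \<open>x = z\<close>.\<close>

section \<open>Orthonormal eigenbases\<close>

text \<open>Completeness is the expansion identity itself, from which Parseval and comparison of
  coordinates follow at once.\<close>

definition orthonormal_basis :: "'a::euclidean_space set \<Rightarrow> bool" where
  "orthonormal_basis B \<longleftrightarrow> finite B \<and> (\<forall>b\<in>B. \<forall>c\<in>B. b \<bullet> c = (if b = c then 1 else 0)) \<and>
     (\<forall>x. x = (\<Sum>b\<in>B. (x \<bullet> b) *\<^sub>R b))"

lemma orthonormal_basis_inner:
  assumes "orthonormal_basis B"
  shows "x \<bullet> y = (\<Sum>b\<in>B. (x \<bullet> b) * (y \<bullet> b))"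
proof -
  have "x = (\<Sum>b\<in>B. (x \<bullet> b) *\<^sub>R b)"
    using assms unfolding orthonormal_basis_def by blast
  then have "x \<bullet> y = (\<Sum>b\<in>B. (x \<bullet> b) *\<^sub>R b) \<bullet> y"
    by simp
  also have "\<dots> = (\<Sum>b\<in>B. (x \<bullet> b) * (y \<bullet> b))"
    by (simp add: inner_sum_left inner_commute[of y])
  finally show ?thesis .
qed

lemma orthonormal_basis_eqI:
  assumes "orthonormal_basis B" and "\<And>b. b \<in> B \<Longrightarrow> x \<bullet> b = y \<bullet> b"
  shows "x = y"
proof -
  have "x = (\<Sum>b\<in>B. (x \<bullet> b) *\<^sub>R b)" "y = (\<Sum>b\<in>B. (y \<bullet> b) *\<^sub>R b)"
    using assms(1) unfolding orthonormal_basis_def by blast+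
  then show ?thesis
    using assms(2) by (metis (no_types, lifting) sum.cong)
qed

lemma orthonormal_basis_nonzero: "orthonormal_basis B \<Longrightarrow> b \<in> B \<Longrightarrow> b \<noteq> 0"
  unfolding orthonormal_basis_def by force

text \<open>Stated for any matrix diagonal in \<open>B\<close>, so that it serves both
  \<open>A\<close> and the matrices \<open>lai_C A T t\<close>.\<close>

lemma diagonal_inner:
  fixes M :: "real^'n^'n"
  assumes B: "orthonormal_basis B" and M: "\<And>b. b \<in> B \<Longrightarrow> M *v b = f b *\<^sub>R b" and "b \<in> B"
  shows "(M *v x) \<bullet> b = f b * (x \<bullet> b)"
proof -
  have fin: "finite B" and on: "\<And>c. c \<in> B \<Longrightarrow> c \<bullet> b = (if c = b then 1 else 0)"
    using B \<open>b \<in> B\<close> unfolding orthonormal_basis_def by auto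
  have "x = (\<Sum>c\<in>B. (x \<bullet> c) *\<^sub>R c)"
    using B unfolding orthonormal_basis_def by blast
  then have "M *v x = M *v (\<Sum>c\<in>B. (x \<bullet> c) *\<^sub>R c)"
    by simp
  also have "\<dots> = (\<Sum>c\<in>B. M *v ((x \<bullet> c) *\<^sub>R c))"
    by (simp add: linear_sum)
  also have "\<dots> = (\<Sum>c\<in>B. (x \<bullet> c * f c) *\<^sub>R c)"
    by (intro sum.cong refl) (simp add: M matrix_vector_mult_scaleR)
  finally have "(M *v x) \<bullet> b = (\<Sum>c\<in>B. if c = b then x \<bullet> c * f c else 0)"
    by (simp add: inner_sum_left on if_distrib cong: sum.cong if_cong)
  then show ?thesis
    using fin \<open>b \<in> B\<close> by simp
qed

text \<open>\<open>M\<close> scales each coordinate by a nonzero factor, so its kernel is trivial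
  and it is invertible.\<close>

lemma diagonal_matrix_inv:
  fixes M :: "real^'n^'n"
  assumes B: "orthonormal_basis B" and M: "\<And>b. b \<in> B \<Longrightarrow> M *v b = f b *\<^sub>R b"
    and nz: "\<And>b. b \<in> B \<Longrightarrow> f b \<noteq> 0" and "b \<in> B"
  shows "matrix_inv M *v b = (1 / f b) *\<^sub>R b"
proof -
  have "x = 0" if "M *v x = 0" for x
  proof (rule orthonormal_basis_eqI[OF B])
    fix c assume "c \<in> B"
    then show "x \<bullet> c = 0 \<bullet> c"
      using diagonal_inner[OF B M, of c x] nz[of c] that by simp
  qed
  then have "\<exists>N. N ** M = mat 1"
    by (simp add: matrix_left_invertible_ker)
  then have "invertible M"
    by (simp add: invertible_left_inverse)
  then have "matrix_inv M ** M = mat 1"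
    unfolding invertible_def matrix_inv_def by (rule someI2_ex) blast
  then have "b = matrix_inv M *v (M *v b)"
    by (simp add: matrix_vector_mul_assoc)
  also have "\<dots> = f b *\<^sub>R (matrix_inv M *v b)"
    by (simp add: M \<open>b \<in> B\<close> matrix_vector_mult_scaleR)
  finally have "(1 / f b) *\<^sub>R b = (1 / f b) *\<^sub>R (f b *\<^sub>R (matrix_inv M *v b))"
    by simp
  then show ?thesis
    using nz[OF \<open>b \<in> B\<close>] by simp
qed

lemma symmetric_inner:
  fixes A :: "real^'n^'n"
  assumes "transpose A = A"
  shows "x \<bullet> (A *v y) = (A *v x) \<bullet> y"
  by (metis assms dot_lmul_matrix transpose_matrix_vector)

text \<open>A maximiser of the Rayleigh quotient on an invariant subspace is an eigenvector.\<close>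
lemma symmetric_eigenvector_in_subspace:
  fixes A :: "real^'n^'n"
  assumes sym: "transpose A = A" and S: "subspace S" and inv: "\<And>x. x \<in> S \<Longrightarrow> A *v x \<in> S"
    and "y \<in> S" "y \<noteq> 0"
  obtains u c where "u \<in> S" "norm u = 1" "A *v u = c *\<^sub>R u"
proof -
  let ?K = "S \<inter> sphere 0 1"
  have "compact ?K"
    using closed_subspace[OF S] by (simp add: closed_Int_compact)
  moreover have "(1 / norm y) *\<^sub>R y \<in> ?K"
    using assms by (simp add: subspace_scale)
  moreover have "continuous_on ?K (\<lambda>x. x \<bullet> (A *v x))"
    by (intro continuous_intros linear_continuous_on_compose[of _ _ "(*v) A"]) auto
  ultimately obtain u where u: "u \<in> ?K" and max: "\<And>x. x \<in> ?K \<Longrightarrow> x \<bullet> (A *v x) \<le> u \<bullet> (A *v u)"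
    using continuous_attains_sup[of ?K "\<lambda>x. x \<bullet> (A *v x)"] by blast
  define m where "m = u \<bullet> (A *v u)"
  have uS: "u \<in> S" and nu: "norm u = 1"
    using u by auto
  have le: "x \<bullet> (A *v x) \<le> m * (x \<bullet> x)" if "x \<in> S" for x
  proof (cases "x = 0")
    case False
    have "(1 / norm x) *\<^sub>R x \<in> ?K"
      using S that False by (simp add: subspace_scale)
    from max[OF this] have "(x \<bullet> (A *v x)) / (norm x)\<^sup>2 \<le> m"
      by (simp add: matrix_vector_mult_scaleR m_def power2_eq_square divide_simps)
    then show ?thesis
      using False by (simp add: divide_simps power2_norm_eq_inner split: if_splits)
  qed simp
  define w where "w = A *v u - m *\<^sub>R u"
  have wS: "w \<in> S"
    unfolding w_def by (intro subspace_diff subspace_scale S inv uS)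
  define k where "k = m * (w \<bullet> w) - w \<bullet> (A *v w)"
  \<comment> \<open>Maximality of \<open>u\<close> is tested at \<open>u + t *\<^sub>R w\<close>.
    The terms in \<open>u \<bullet> w\<close> cancel, so a first-order term in \<open>t\<close> is
    bounded by a second-order one.\<close>
  have ineq: "2 * t * (w \<bullet> w) \<le> t\<^sup>2 * k" for t :: real
  proof -
    have "u + t *\<^sub>R w \<in> S"
      by (intro subspace_add subspace_scale S uS wS)
    note le[OF this]
    moreover have "u \<bullet> (A *v w) = (A *v u) \<bullet> w"
      by (rule symmetric_inner[OF sym])
    moreover have "u \<bullet> (A *v u) = m" "u \<bullet> u = 1"
      using nu by (simp_all add: m_def norm_eq_1)
    moreover have "A *v u = w + m *\<^sub>R u"
      by (simp add: w_def)
    ultimately show ?thesis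
      by (simp add: matrix_vector_right_distrib matrix_vector_mult_scaleR inner_add_left
        inner_add_right inner_commute k_def power2_eq_square algebra_simps)
  qed
  have "w = 0"
  proof (rule ccontr)
    assume "w \<noteq> 0"
    then have pos: "w \<bullet> w > 0"
      by simp
    \<comment> \<open>Small enough that \<open>t * k\<close> is at most
      \<open>w \<bullet> w\<close>; the \<open>+ 1\<close> covers \<open>k = 0\<close>.\<close>
    define t where "t = (w \<bullet> w) / (\<bar>k\<bar> + 1)"
    have "t > 0"
      using pos by (simp add: t_def)
    have "2 * (w \<bullet> w) \<le> t * k"
      using ineq[of t] \<open>t > 0\<close> by (simp add: power2_eq_square)
    also have "\<dots> \<le> t * (\<bar>k\<bar> + 1)"
      using \<open>t > 0\<close> by (intro mult_left_mono) auto
    also have "\<dots> = w \<bullet> w"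
      by (simp add: t_def add_nonneg_eq_0_iff)
    finally show False
      using pos by simp
  qed
  then show ?thesis
    using that[OF uS nu, of m] by (simp add: w_def)
qed

text \<open>A largest orthonormal set of eigenvectors is complete: by symmetry its orthogonal
  complement is invariant, and a nonzero vector there would yield one more eigenvector.\<close>

lemma symmetric_orthonormal_eigenbasis:
  fixes A :: "real^'n^'n"
  assumes sym: "transpose A = A"
  obtains B f where "orthonormal_basis B" "\<And>b. b \<in> B \<Longrightarrow> A *v b = f b *\<^sub>R b"
proof -
  define Q where "Q B \<longleftrightarrow> (\<forall>b\<in>B. \<forall>c\<in>B. b \<bullet> c = (if b = c then 1 else 0)) \<and>
    (\<forall>b\<in>B. \<exists>a. A *v b = a *\<^sub>R b)" for B
  \<comment> \<open>Orthonormal sets are independent, so the dimension bounds their size and a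
    largest one exists.\<close>
  have bound: "finite B \<and> card B \<le> DIM(real^'n)" if "Q B" for B
  proof -
    have "pairwise orthogonal B" "0 \<notin> B"
      using that unfolding Q_def pairwise_def orthogonal_def by force+
    then show ?thesis
      using independent_bound pairwise_orthogonal_independent by blast
  qed
  have "Q {}"
    by (simp add: Q_def)
  then obtain B where QB: "Q B" and max: "\<And>B'. Q B' \<Longrightarrow> card B' \<le> card B"
    using ex_has_greatest_nat[of Q "{}" card "Suc (DIM(real^'n))"] bound le_imp_less_Suc by blast
  have fin: "finite B" and on: "\<And>b c. b \<in> B \<Longrightarrow> c \<in> B \<Longrightarrow> b \<bullet> c = (if b = c then 1 else 0)"
    using QB bound[OF QB] unfolding Q_def by auto
  obtain f where f: "\<And>b. b \<in> B \<Longrightarrow> A *v b = f b *\<^sub>R b"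
    using QB unfolding Q_def by metis
  define S where "S = {x. \<forall>b\<in>B. x \<bullet> b = 0}"
  have S: "subspace S"
    by (auto simp: S_def subspace_def inner_add_left)
  have inv: "A *v x \<in> S" if "x \<in> S" for x
    using that by (auto simp: S_def symmetric_inner[OF sym, symmetric] f)
  have S0: "y = 0" if y: "y \<in> S" for y
  proof (rule ccontr)
    assume "y \<noteq> 0"
    then obtain u c where u: "u \<in> S" "norm u = 1" "A *v u = c *\<^sub>R u"
      using symmetric_eigenvector_in_subspace[OF sym S inv y] by metis
    have uu: "u \<bullet> u = 1"
      using u by (simp add: norm_eq_1)
    have "u \<notin> B"
      using u uu unfolding S_def by auto
    have "Q (insert u B)"
      using QB u uu \<open>u \<notin> B\<close> unfolding Q_def S_def by (auto simp: inner_commute)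
    from max[OF this] show False
      using fin \<open>u \<notin> B\<close> by simp
  qed
  have "x = (\<Sum>b\<in>B. (x \<bullet> b) *\<^sub>R b)" for x
  proof -
    have "(\<Sum>b\<in>B. (x \<bullet> b) *\<^sub>R b) \<bullet> c = x \<bullet> c" if "c \<in> B" for c
    proof -
      have "(\<Sum>b\<in>B. (x \<bullet> b) *\<^sub>R b) \<bullet> c = (\<Sum>b\<in>B. if b = c then x \<bullet> b else 0)"
        using that by (auto simp: inner_sum_left on intro!: sum.cong)
      then show ?thesis
        using fin that by simp
    qed
    then have "x - (\<Sum>b\<in>B. (x \<bullet> b) *\<^sub>R b) \<in> S"
      by (simp add: S_def inner_diff_left)
    from S0[OF this] show ?thesis
      by simp
  qed
  then have "orthonormal_basis B"
    using fin on unfolding orthonormal_basis_def by blast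
  then show ?thesis
    using that f by blast
qed

text \<open>An eigenvector has a nonzero coordinate along some \<open>b\<close>, which forces its
  eigenvalue to be \<open>f b\<close>. Hence \<open>lambda_min\<close> is the minimum of a finite
  set.\<close>

lemma eigenvalues_eigenbasis:
  fixes A :: "real^'n^'n"
  assumes B: "orthonormal_basis B" and f: "\<And>b. b \<in> B \<Longrightarrow> A *v b = f b *\<^sub>R b"
  shows "eigenvalues A = f ` B"
proof
  show "f ` B \<subseteq> eigenvalues A"
    using f orthonormal_basis_nonzero[OF B] unfolding eigenvalues_def by blast
  show "eigenvalues A \<subseteq> f ` B"
  proof
    fix c assume "c \<in> eigenvalues A"
    then obtain u where u: "u \<noteq> 0" "A *v u = c *\<^sub>R u"
      unfolding eigenvalues_def by blast
    obtain b where b: "b \<in> B" "u \<bullet> b \<noteq> 0"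
      using orthonormal_basis_eqI[OF B, of u 0] u by auto
    then show "c \<in> f ` B"
      using diagonal_inner[OF B f, of b u] u by auto
  qed
qed

section \<open>The one-dimensional problem\<close>

text \<open>Scalar Riccati recursion: over \<open>y\<close>, the minimum of
  \<open>a * y\<^sup>2 + (y - x)\<^sup>2 + p * y\<^sup>2\<close> is
  \<open>(1 - 1 / (1 + a + p)) * x\<^sup>2\<close>, attained at
  \<open>y = x / (1 + a + p)\<close>.\<close>

primrec cost_to_go :: "real \<Rightarrow> nat \<Rightarrow> real" where
  "cost_to_go a 0 = 0"
| "cost_to_go a (Suc n) = 1 - 1 / (1 + a + cost_to_go a n)"

lemma cost_to_go_bounds:
  assumes "a > 0"
  shows "0 \<le> cost_to_go a n \<and> cost_to_go a n < 1"
  using assms by (induction n) (auto simp: divide_simps)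

text \<open>The slack is a quadratic form of rank two in \<open>(w, e, D)\<close>, where \<open>w = x - v\<close>, \<open>e = z' - v\<close> and
  \<open>D = z - x\<close>: the square completed in \<open>D\<close> leaves the term \<open>\<kappa> * (e - w)\<^sup>2\<close>, and what then remains in
  \<open>(w, e)\<close> has discriminant \<open>0\<close>.\<close>
lemma potential_step_form:
  fixes a p w e D :: real
  assumes a: "a > 0" and p: "0 \<le> p" "p < 1" and c: "c = 1 / (1 + a + p)"
  shows "a * (c * w)\<^sup>2 + (c * w - w)\<^sup>2 + (1 + a) * p * (c * w - e)\<^sup>2
    \<le> (1 + 1 / a) * (a * e\<^sup>2 + (e - w - D)\<^sup>2) + (1 + a) * (1 - c) * D\<^sup>2"
proof -
  define M where "M = 1 + a + a\<^sup>2 + p + a * p"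
  \<comment> \<open>This is \<open>\<alpha> * \<beta> / (\<alpha> + \<beta>)\<close> for the weights
    \<open>\<alpha>\<close> and \<open>\<beta>\<close> of the two squares containing
    \<open>D\<close>, the factor left after minimising over \<open>D\<close>.\<close>
  define \<kappa> where "\<kappa> = (1 + a) * (a + p) / M"
  have M: "M > 0"
    unfolding M_def using a p by (intro add_pos_nonneg) auto
  have s: "1 + a + p > 0"
    using a p by simp
  have cs: "c * (1 + a + p) = 1"
    using s c by simp
  have \<kappa>: "\<kappa> * M = (1 + a) * (a + p)" "\<kappa> > 0"
    using M a p by (auto simp: \<kappa>_def)
  \<comment> \<open>\<open>E\<close>, \<open>2 * X\<close> and \<open>W\<close> are the coefficients
    of \<open>e\<^sup>2\<close>, \<open>e * w\<close> and \<open>w\<^sup>2\<close> in the slack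
    after that minimisation.\<close>
  define E where "E = \<kappa> + (1 + a) * (1 - p)"
  define X where "X = (1 + a) * p * c - \<kappa>"
  define W where "W = \<kappa> - a * c\<^sup>2 - (c - 1)\<^sup>2 - (1 + a) * p * c\<^sup>2"
  have E: "E > 0"
    unfolding E_def using \<kappa> a p by (intro add_pos_nonneg) auto
  \<comment> \<open>With denominators cleared, all three coefficients are multiples of the same
    \<open>F\<close>.\<close>
  have disc: "E * W = X\<^sup>2"
  proof -
    define F where "F = 1 + (a + p) * (1 - p)"
    have "E * M = (1 + a)\<^sup>2 * F"
      using \<kappa>(1) unfolding E_def F_def M_def by algebra
    moreover have "X * (1 + a + p) * M = - ((1 + a) * a * F)"
      using \<kappa>(1) cs unfolding X_def F_def M_def by algebra
    moreover have "W * (1 + a + p)\<^sup>2 * M = a\<^sup>2 * F"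
      using \<kappa>(1) cs unfolding W_def F_def M_def by algebra
    ultimately have "(E * W) * ((1 + a + p) * M)\<^sup>2 = X\<^sup>2 * ((1 + a + p) * M)\<^sup>2"
      by algebra
    then show ?thesis
      using M s by simp
  qed
  have "0 \<le> (E * e + X * w)\<^sup>2 / E"
    using E by simp
  also have "\<dots> = E * e\<^sup>2 + 2 * X * e * w + W * w\<^sup>2"
    using E disc by (simp add: field_simps power2_eq_square)
  finally have 1: "0 \<le> E * e\<^sup>2 + 2 * X * e * w + W * w\<^sup>2" .
  have 2: "\<kappa> * (e - w)\<^sup>2 \<le> (1 + 1 / a) * (e - w - D)\<^sup>2 + (1 + a) * (1 - c) * D\<^sup>2"
  proof -
    define \<alpha> where "\<alpha> = 1 + 1 / a"
    define \<beta> where "\<beta> = (1 + a) * (1 - c)"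
    have "\<alpha> > 0"
      using a by (simp add: \<alpha>_def add_pos_pos)
    moreover have "\<beta> \<ge> 0"
      using a p s by (simp add: \<beta>_def c)
    ultimately have pos: "\<alpha> + \<beta> > 0"
      by simp
    have "a * \<alpha> = 1 + a" "\<beta> * (1 + a + p) = (1 + a) * (a + p)"
      using a cs unfolding \<alpha>_def \<beta>_def by (simp_all add: field_simps)
    then have "(\<kappa> * (\<alpha> + \<beta>)) * (a * (1 + a + p) * M) = (\<alpha> * \<beta>) * (a * (1 + a + p) * M)"
      using \<kappa>(1) M_def by algebra
    then have "\<kappa> * (\<alpha> + \<beta>) = \<alpha> * \<beta>"
      using a s M by simp
    then have "(\<alpha> + \<beta>) * (\<alpha> * (e - w - D)\<^sup>2 + \<beta> * D\<^sup>2 - \<kappa> * (e - w)\<^sup>2)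
      = ((\<alpha> + \<beta>) * D - \<alpha> * (e - w))\<^sup>2"
      by algebra
    then have "0 \<le> (\<alpha> + \<beta>) * (\<alpha> * (e - w - D)\<^sup>2 + \<beta> * D\<^sup>2 - \<kappa> * (e - w)\<^sup>2)"
      by simp
    then show ?thesis
      using pos unfolding \<alpha>_def \<beta>_def by (simp add: zero_le_mult_iff)
  qed
  have "a * (c * w)\<^sup>2 + (c * w - w)\<^sup>2 + (1 + a) * p * (c * w - e)\<^sup>2
    = (1 + a) * e\<^sup>2 + \<kappa> * (e - w)\<^sup>2 - (E * e\<^sup>2 + 2 * X * e * w + W * w\<^sup>2)"
    unfolding E_def X_def W_def by algebra
  also have "\<dots> \<le> (1 + a) * e\<^sup>2 + ((1 + 1 / a) * (e - w - D)\<^sup>2 + (1 + a) * (1 - c) * D\<^sup>2)"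
    using 1 2 by linarith
  also have "\<dots> = (1 + 1 / a) * (a * e\<^sup>2 + (e - w - D)\<^sup>2) + (1 + a) * (1 - c) * D\<^sup>2"
    using a by (simp add: field_simps)
  finally show ?thesis .
qed

lemma scalar_competitive:
  fixes a :: real and x z v :: "nat \<Rightarrow> real"
  assumes a: "a > 0" and x0: "x 0 = z 0"
    and x: "\<And>t. t < T \<Longrightarrow> x (Suc t) - v (Suc t)
      = 1 / (1 + a + cost_to_go a (T - Suc t)) * (x t - v (Suc t))"
  shows "(\<Sum>t=1..T. a * (x t - v t)\<^sup>2 + (x t - x (t - 1))\<^sup>2)
    \<le> (1 + 1 / a) * (\<Sum>t=1..T. a * (z t - v t)\<^sup>2 + (z t - z (t - 1))\<^sup>2)"
proof -
  \<comment> \<open>The common factor 1/2 is dropped. \<open>\<Phi> 0 = 0\<close> because both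
    trajectories start together, and \<open>\<Phi> T = 0\<close> because no rounds remain.\<close>
  define \<Phi> where "\<Phi> t = (1 + a) * cost_to_go a (T - t) * (x t - z t)\<^sup>2" for t
  have "(\<Sum>t=1..n. a * (x t - v t)\<^sup>2 + (x t - x (t - 1))\<^sup>2) + \<Phi> n
    \<le> (1 + 1 / a) * (\<Sum>t=1..n. a * (z t - v t)\<^sup>2 + (z t - z (t - 1))\<^sup>2)" if "n \<le> T" for n
    using that
  proof (induction n)
    case 0
    then show ?case
      by (simp add: \<Phi>_def x0)
  next
    case (Suc n)
    define p where "p = cost_to_go a (T - Suc n)"
    define c where "c = 1 / (1 + a + p)"
    define w where "w = x n - v (Suc n)"
    have xS: "x (Suc n) = v (Suc n) + c * w"
      using x[of n] Suc.prems by (simp add: c_def p_def w_def)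
    have "T - n = Suc (T - Suc n)"
      using Suc.prems by simp
    then have "cost_to_go a (T - n) = 1 - c"
      by (simp add: c_def p_def)
    then have \<Phi>: "\<Phi> n = (1 + a) * (1 - c) * (z n - x n)\<^sup>2"
      by (simp add: \<Phi>_def power2_commute)
    \<comment> \<open>Here \<open>e\<close> is \<open>z (Suc n) - v (Suc n)\<close> and
      \<open>D\<close> is \<open>z n - x n\<close>.\<close>
    have "a * (c * w)\<^sup>2 + (c * w - w)\<^sup>2 + (1 + a) * p * (c * w - (z (Suc n) - v (Suc n)))\<^sup>2
      \<le> (1 + 1 / a) * (a * (z (Suc n) - v (Suc n))\<^sup>2
          + ((z (Suc n) - v (Suc n)) - w - (z n - x n))\<^sup>2) + (1 + a) * (1 - c) * (z n - x n)\<^sup>2"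
      using cost_to_go_bounds[OF a] by (intro potential_step_form a) (auto simp: p_def c_def)
    moreover have "(z (Suc n) - v (Suc n)) - w - (z n - x n) = z (Suc n) - z n"
      by (simp add: w_def)
    moreover have "c * w = x (Suc n) - v (Suc n)" "c * w - w = x (Suc n) - x n"
      "c * w - (z (Suc n) - v (Suc n)) = x (Suc n) - z (Suc n)"
      by (simp_all add: xS w_def)
    moreover have "\<Phi> (Suc n) = (1 + a) * p * (x (Suc n) - z (Suc n))\<^sup>2"
      by (simp add: \<Phi>_def p_def)
    ultimately have "a * (x (Suc n) - v (Suc n))\<^sup>2 + (x (Suc n) - x n)\<^sup>2 + \<Phi> (Suc n)
      \<le> (1 + 1 / a) * (a * (z (Suc n) - v (Suc n))\<^sup>2 + (z (Suc n) - z n)\<^sup>2) + \<Phi> n"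
      unfolding \<Phi> by metis
    with Suc.IH Suc.prems show ?case
      by (simp add: distrib_left)
  qed
  from this[of T] show ?thesis
    by (simp add: \<Phi>_def)
qed

section \<open>Decoupling\<close>

text \<open>Backward induction on the rounds left. It ranges over all of \<open>B\<close> at once,
  since inverting a matrix needs its action on the whole basis.\<close>

lemma lai_C_eigenvector:
  fixes A :: "real^'n^'n"
  assumes B: "orthonormal_basis B" and f: "\<And>b. b \<in> B \<Longrightarrow> A *v b = f b *\<^sub>R b"
    and pos: "\<And>b. b \<in> B \<Longrightarrow> f b > 0" and "b \<in> B"
  shows "lai_C A T t *v b = (1 / (1 + f b + cost_to_go (f b) (T - t))) *\<^sub>R b"
  using \<open>b \<in> B\<close>
proof (induction "T - t" arbitrary: t b)
  case 0
  have "matrix_inv (mat 1 + A) *v b = (1 / (1 + f b)) *\<^sub>R b"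
    using pos 0 by (intro diagonal_matrix_inv[OF B])
      (force simp: matrix_vector_mult_add_rdistrib f scaleR_left_distrib)+
  with 0 show ?case
    by (simp add: lai_C.simps[of A T t])
next
  case (Suc n)
  have n: "n = T - Suc t" and Tt: "T - t = Suc n" and "t < T"
    using Suc.hyps(2) by simp_all
  let ?g = "\<lambda>b. 2 + f b - 1 / (1 + f b + cost_to_go (f b) n)"
  \<comment> \<open>The LAI recursion becomes the Riccati recursion:
    \<open>2 + a - c = 1 + a + (1 - c)\<close>, where \<open>1 - c\<close> is the next
    \<open>cost_to_go\<close>.\<close>
  have g: "?g b = 1 + f b + cost_to_go (f b) (T - t)" for b
    by (simp add: Tt)
  have "matrix_inv (2 *\<^sub>R mat 1 + A - lai_C A T (Suc t)) *v b = (1 / ?g b) *\<^sub>R b"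
  proof (rule diagonal_matrix_inv[OF B _ _ \<open>b \<in> B\<close>])
    fix c assume "c \<in> B"
    then show "?g c \<noteq> 0"
      using cost_to_go_bounds[OF pos, of c "T - t"] pos[of c] unfolding g by force
    have "lai_C A T (Suc t) *v c = (1 / (1 + f c + cost_to_go (f c) n)) *\<^sub>R c"
      using Suc.hyps(1)[OF n \<open>c \<in> B\<close>] n by simp
    then show "(2 *\<^sub>R mat 1 + A - lai_C A T (Suc t)) *v c = ?g c *\<^sub>R c"
      by (simp add: matrix_vector_mult_add_rdistrib matrix_vector_mult_diff_rdistrib
        scaleR_matrix_vector_assoc[symmetric] f \<open>c \<in> B\<close> scaleR_left_distrib scaleR_left_diff_distrib)
  qed
  then show ?case
    using \<open>t < T\<close> by (simp only: g lai_C.simps[of A T t] if_True)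
qed

text \<open>Parseval splits both the \<open>A\<close>-form and the norm into coordinates; swapping
  the sums gives one scalar problem per eigenvector.\<close>

lemma total_cost_eigenbasis:
  fixes A :: "real^'n^'n"
  assumes B: "orthonormal_basis B" and f: "\<And>b. b \<in> B \<Longrightarrow> A *v b = f b *\<^sub>R b"
  shows "total_cost A T v x = 1/2 * (\<Sum>b\<in>B. \<Sum>t=1..T.
    f b * (x t \<bullet> b - v t \<bullet> b)\<^sup>2 + (x t \<bullet> b - x (t - 1) \<bullet> b)\<^sup>2)"
proof -
  have norm: "(norm y)\<^sup>2 = (\<Sum>b\<in>B. (y \<bullet> b)\<^sup>2)" for y
    using orthonormal_basis_inner[OF B, of y y] unfolding power2_norm_eq_inner by (simp only: power2_eq_square)
  have "hitting_cost A (v t) (x t) + switching_cost (x t) (x (t - 1)) =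
      1/2 * (\<Sum>b\<in>B. f b * (x t \<bullet> b - v t \<bullet> b)\<^sup>2 + (x t \<bullet> b - x (t - 1) \<bullet> b)\<^sup>2)" for t
    unfolding hitting_cost_def switching_cost_def norm
      orthonormal_basis_inner[OF B, of "x t - v t" "A *v (x t - v t)"]
    by (simp add: diagonal_inner[OF B f] inner_diff_left power2_eq_square mult_ac
      sum.distrib distrib_left)
  then show ?thesis
    unfolding total_cost_def by (subst sum.swap) (simp only: sum_distrib_left)
qed

theorem theorem3p8:
  fixes A :: "real^'n^'n"
  assumes "pos_def A"
  shows "competitive_ratio_le A (lai A) (1 + 1 / lambda_min A)"
proof -
  have sym: "transpose A = A" and pd: "\<And>x. x \<noteq> 0 \<Longrightarrow> x \<bullet> (A *v x) > 0"
    using assms by (auto simp: pos_def_def)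
  obtain B f where B: "orthonormal_basis B" and f: "\<And>b. b \<in> B \<Longrightarrow> A *v b = f b *\<^sub>R b"
    using symmetric_orthonormal_eigenbasis[OF sym] by blast
  have pos: "f b > 0" if "b \<in> B" for b
  proof -
    have "b \<bullet> b > 0"
      using orthonormal_basis_nonzero[OF B that] by simp
    then show ?thesis
      using pd[OF orthonormal_basis_nonzero[OF B that]] zero_less_mult_pos2[of "f b" "b \<bullet> b"]
      by (simp add: f that)
  qed
  have "B \<noteq> {}"
    using orthonormal_basis_eqI[OF B, of "1 :: real^'n" 0] by auto
  moreover have "finite B"
    using B by (simp add: orthonormal_basis_def)
  ultimately have lam_le: "\<And>b. b \<in> B \<Longrightarrow> lambda_min A \<le> f b" and lam_pos: "lambda_min A > 0"
    using pos by (auto simp: lambda_min_def eigenvalues_eigenbasis[OF B f])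
  let ?\<rho> = "1 + 1 / lambda_min A"
  have \<rho>: "?\<rho> > 0"
    using lam_pos by (simp add: add_pos_pos)
  have main: "total_cost A T v (lai A T x0 v) \<le> ?\<rho> * total_cost A T v z" if "z 0 = x0" for T x0 v z
  proof -
    let ?x = "lai A T x0 v"
    let ?c = "\<lambda>x b. \<Sum>t=1..T. f b * (x t \<bullet> b - v t \<bullet> b)\<^sup>2 + (x t \<bullet> b - x (t - 1) \<bullet> b)\<^sup>2"
    have "?c ?x b \<le> ?\<rho> * ?c z b" if b: "b \<in> B" for b
    proof -
      have "?c ?x b \<le> (1 + 1 / f b) * ?c z b"
      proof (rule scalar_competitive[OF pos[OF b]])
        show "?x 0 \<bullet> b = z 0 \<bullet> b"
          using \<open>z 0 = x0\<close> by simp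
        fix t
        note C = diagonal_inner[OF B lai_C_eigenvector[OF B f pos] b]
        show "?x (Suc t) \<bullet> b - v (Suc t) \<bullet> b
          = 1 / (1 + f b + cost_to_go (f b) (T - Suc t)) * (?x t \<bullet> b - v (Suc t) \<bullet> b)"
          by (simp add: matrix_vector_mult_diff_rdistrib inner_add_left inner_diff_left C
            right_diff_distrib diff_divide_distrib)
      qed
      \<comment> \<open>\<open>1 + 1 / a\<close> decreases in \<open>a\<close>, so the smallest
        eigenvalue gives the worst factor.\<close>
      also have "\<dots> \<le> ?\<rho> * ?c z b"
        using lam_le[OF b] lam_pos pos[OF b]
        by (intro mult_right_mono add_left_mono divide_left_mono sum_nonneg add_nonneg_nonneg) auto
      finally show ?thesis .
    qed
    then have "(\<Sum>b\<in>B. ?c ?x b) \<le> (\<Sum>b\<in>B. ?\<rho> * ?c z b)"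
      by (rule sum_mono)
    then show ?thesis
      by (simp add: total_cost_eigenbasis[OF B f] sum_distrib_left[symmetric])
  qed
  \<comment> \<open>Dividing by \<open>?\<rho>\<close> gives one lower bound for all competitors,
    hence for their infimum.\<close>
  have "total_cost A T v (lai A T x0 v) / ?\<rho> \<le> opt_cost A T x0 v" for T x0 v
    unfolding opt_cost_def
  proof (rule cINF_greatest)
    show "{x :: nat \<Rightarrow> real^'n. x 0 = x0} \<noteq> {}"
      by auto
  next
    fix z :: "nat \<Rightarrow> real^'n" assume "z \<in> {x. x 0 = x0}"
    then show "total_cost A T v (lai A T x0 v) / ?\<rho> \<le> total_cost A T v z"
      using main[of z x0 T v] \<rho> by (simp add: pos_divide_le_eq mult.commute)
  qed
  then show ?thesis
    using \<rho> unfolding competitive_ratio_le_def by (simp add: pos_divide_le_eq mult.commute)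
qed

end
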